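(* If $X=\mathbb{P}(w_1,\dots,w_r)$ is the weighted projective space, then its vanishing ideal satisfies $I(X(\mathbb{F}_q))=I(\mathbb{A}^r_G(\mathbb{F}_q))$.
   Context: $\mathbb{F}_q$ is a finite field, $\mathbb{K}=\overline{\mathbb{F}}_q$ an algebraic closure. Let $r\ge2$ and let $w_1,\dots,w_r$ be positive integers such that any $r-1$ of them have no nontrivial common divisor, i.e. $\gcd(w_1,\dots,\widehat{w_i},\dots,w_r)=1$ for every $i\in\{1,\dots,r\}$. $S=\mathbb{F}_q[x_1,\dots,x_r]$ is graded by $\deg(x_i)=w_i$; "homogeneous" refers to this grading. The group $G=\{(t^{w_1},\dots,t^{w_r}):t\in\mathbb{K}^*\}$ acts on $\mathbb{K}^r$ by coordinatewise multiplication. $\mathbb{A}^r_G(\mathbb{F}_q)=\mathbb{F}_q^r/G$ is the set of $G$-orbits of points of $\mathbb{F}_q^r$; $X=(\mathbb{K}^r\setminus\{0\})/G$, and $X(\mathbb{F}_q)$ is identified with the set of $G$-orbits of points of $\mathbb{F}_q^r\setminus\{0\}$. For a set $Y_G$ of orbits, $I(Y_G)\subseteq S$ is the ideal generated by the homogeneous polynomials in $S$ vanishing at all $P$ with $G\cdot P\in Y_G$ (for homogeneous $F$, vanishing at $P$ depends only on the orbit). *)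

theory Defs
  imports
    "HOL-Algebra.Algebraic_Closure_Type"
    "HOL-Analysis.Finite_Cartesian_Product"
    "HOL-Library.Poly_Mapping"
begin

text \<open>
  Throughout, \<open>'q :: {field, finite}\<close> is the finite field \<open>F\<^sub>q\<close>, \<open>'q alg_closure\<close> is its algebraic
  closure \<open>K\<close>, and the variables \<open>x\<^sub>1, \<dots>, x\<^sub>r\<close> are indexed by a finite type \<open>'n\<close> with
  \<open>CARD('n) = r\<close>. An element of \<open>S = F\<^sub>q[x\<^sub>1, \<dots>, x\<^sub>r]\<close> maps each exponent vector to its coefficient;
  the ring structure on this type is the one of a monoid algebra.
\<close>

type_synonym ('n, 'q) mpoly = "('n \<Rightarrow>\<^sub>0 nat) \<Rightarrow>\<^sub>0 'q"

definition eval_ac :: "('n::finite, 'q::field) mpoly \<Rightarrow> 'q alg_closure ^ 'n \<Rightarrow> 'q alg_closure" where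
  "eval_ac F P =
    (\<Sum>m\<in>Poly_Mapping.keys F.
       to_ac (Poly_Mapping.lookup F m) * (\<Prod>i\<in>UNIV. (P $ i) ^ Poly_Mapping.lookup m i))"

definition weighted_degree :: "('n::finite \<Rightarrow> nat) \<Rightarrow> ('n \<Rightarrow>\<^sub>0 nat) \<Rightarrow> nat" where
  "weighted_degree w m = (\<Sum>i\<in>UNIV. w i * Poly_Mapping.lookup m i)"

text \<open>The zero polynomial is homogeneous (of every degree).\<close>

definition homogeneous :: "('n::finite \<Rightarrow> nat) \<Rightarrow> ('n, 'q::field) mpoly \<Rightarrow> bool" where
  "homogeneous w F \<longleftrightarrow> (\<exists>d. \<forall>m\<in>Poly_Mapping.keys F. weighted_degree w m = d)"

definition weight_group :: "('n::finite \<Rightarrow> nat) \<Rightarrow> ('q::field alg_closure ^ 'n) set" where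
  "weight_group w = {(\<chi> i. t ^ w i) | t. t \<noteq> 0}"

text \<open>Multiplication of vectors is coordinatewise.\<close>

definition orbit ::
    "('n::finite \<Rightarrow> nat) \<Rightarrow> 'q::field alg_closure ^ 'n \<Rightarrow> ('q alg_closure ^ 'n) set" where
  "orbit w P = (\<lambda>g. g * P) ` weight_group w"

definition orbits ::
    "('n::finite \<Rightarrow> nat) \<Rightarrow> ('q::field alg_closure ^ 'n) set \<Rightarrow> ('q alg_closure ^ 'n) set set" where
  "orbits w A = orbit w ` A"

text \<open>\<open>F\<^sub>q\<^sup>r\<close> as a subset of \<open>K\<^sup>r\<close>.\<close>

definition rational_points :: "('q::field alg_closure ^ 'n::finite) set" where
  "rational_points = {P. \<forall>i. P $ i \<in> range to_ac}"

definition affine_orbits :: "('n::finite \<Rightarrow> nat) \<Rightarrow> ('q::field alg_closure ^ 'n) set set" where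
  "affine_orbits w = orbits w rational_points"

definition weighted_projective_space ::
    "('n::finite \<Rightarrow> nat) \<Rightarrow> ('q::field alg_closure ^ 'n) set set" where
  "weighted_projective_space w = orbits w (UNIV - {0})"

text \<open>\<open>X(F\<^sub>q)\<close>, under its identification with the set of orbits of points of \<open>F\<^sub>q\<^sup>r - {0}\<close>.\<close>

definition weighted_projective_rational_points ::
    "('n::finite \<Rightarrow> nat) \<Rightarrow> ('q::field alg_closure ^ 'n) set set" where
  "weighted_projective_rational_points w = orbits w (rational_points - {0})"

lemma weighted_projective_rational_points_subset:
  "weighted_projective_rational_points w \<subseteq> weighted_projective_space w"
  by (auto simp: weighted_projective_rational_points_def weighted_projective_space_def orbits_def)

definition vanishing_ideal ::
    "('n::finite \<Rightarrow> nat) \<Rightarrow> ('q::field alg_closure ^ 'n) set set \<Rightarrow> ('n, 'q) mpoly set" where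
  "vanishing_ideal w Y =
    genideal ring_of_type_algebra
      {F. homogeneous w F \<and> (\<forall>P. orbit w P \<in> Y \<longrightarrow> eval_ac F P = 0)}"

end

theory Submission
  imports Defs
begin

text \<open>
  Only the point 0 distinguishes the two sets of orbits. A homogeneous polynomial of positive degree
  vanishes at 0, and one of degree 0 is constant because the weights are positive, so it takes the
  same value at 0 as at the nonzero rational point \<open>(1, \<dots>, 1)\<close>. Hence both ideals have the same
  generators.
\<close>

lemma orbit_self: "P \<in> orbit w P"
proof -
  have "(\<chi> i. 1 ^ w i) \<in> weight_group w"
    unfolding weight_group_def by (intro CollectI exI[of _ 1]) simp
  moreover have "P = (\<chi> i. 1 ^ w i) * P"
    by (simp add: vec_eq_iff)
  ultimately show ?thesis
    unfolding orbit_def by blast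
qed

text \<open>Every element of \<open>orbit w 0\<close> is a product \<open>g * 0\<close>, hence 0,
  while \<open>P\<close> lies in its own orbit.\<close>

lemma orbit_eq_orbit_0_iff: "orbit w P = orbit w 0 \<longleftrightarrow> P = 0"
proof
  assume "orbit w P = orbit w 0"
  then show "P = 0"
    using orbit_self[of P w] by (auto simp: orbit_def)
qed simp

lemma zero_rational_point: "0 \<in> rational_points"
  by (auto simp: rational_points_def intro: range_eqI[of _ to_ac 0])

lemma one_rational_point: "1 \<in> rational_points"
  by (auto simp: rational_points_def intro: range_eqI[of _ to_ac 1])

lemma homogeneous_eval_0:
  fixes w :: "'n::finite \<Rightarrow> nat" and F :: "('n, 'q::field) mpoly"
  assumes "\<And>i. w i > 0" and "homogeneous w F" and "eval_ac F 1 = 0"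
  shows "eval_ac F 0 = 0"
proof -
  obtain d where d: "\<And>m. m \<in> Poly_Mapping.keys F \<Longrightarrow> weighted_degree w m = d"
    using assms(2) by (auto simp: homogeneous_def)
  show ?thesis
  proof (cases "d = 0")
    case True
    have "Poly_Mapping.lookup m i = 0" if "m \<in> Poly_Mapping.keys F" for m i
    proof -
      have "w i * Poly_Mapping.lookup m i = 0"
        using d[OF that] True by (simp add: weighted_degree_def)
      then show ?thesis
        using assms(1)[of i] by simp
    qed
    \<comment> \<open>All exponents are 0, so each monomial evaluates to 1 at both points; at the
      origin this uses \<open>0 ^ 0 = 1\<close>.\<close>
    then have "eval_ac F 0 = eval_ac F 1"
      by (simp add: eval_ac_def)
    then show ?thesis
      using assms(3) by simp
  next
    case False
    \<comment> \<open>If all exponents of \<open>m\<close> were 0, its weighted degree would be 0. A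
      positive exponent puts a factor 0 into the monomial at the origin.\<close>
    have "\<exists>i. Poly_Mapping.lookup m i > 0" if "m \<in> Poly_Mapping.keys F" for m
      using d[OF that] False by - (rule ccontr, simp add: weighted_degree_def)
    then show ?thesis
      by (fastforce simp: eval_ac_def intro!: sum.neutral)
  qed
qed

text \<open>Inserting \<open>orbit w 0\<close> adds only the condition
  \<open>eval_ac F 0 = 0\<close> on a generator \<open>F\<close>, and this follows from vanishing at
  \<open>1\<close>, whose orbit lies in \<open>Y\<close>.\<close>

lemma vanishing_ideal_insert_orbit_0:
  fixes Y :: "('q::field alg_closure ^ 'n::finite) set set"
  assumes "\<And>i. w i > 0" and "orbit w 1 \<in> Y"
  shows "vanishing_ideal w (insert (orbit w 0) Y) = vanishing_ideal w Y"
proof -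
  have "(\<forall>P. orbit w P \<in> insert (orbit w 0) Y \<longrightarrow> eval_ac F P = 0) \<longleftrightarrow>
        (\<forall>P. orbit w P \<in> Y \<longrightarrow> eval_ac F P = 0)"
    if "homogeneous w F" for F :: "('n, 'q) mpoly"
    using homogeneous_eval_0[OF assms(1) that] assms(2) by (auto simp: orbit_eq_orbit_0_iff)
  then show ?thesis
    unfolding vanishing_ideal_def by (intro arg_cong[where f = "genideal _"]) blast
qed

lemma affine_orbits_eq_insert:
  "affine_orbits w = insert (orbit w 0) (weighted_projective_rational_points w)"
  using zero_rational_point
  by (auto simp: affine_orbits_def weighted_projective_rational_points_def orbits_def)

theorem proposition5p6:
  fixes w :: "'n::finite \<Rightarrow> nat"
  assumes "CARD('n) \<ge> 2"
    and "\<And>i. w i > 0"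
    and "\<And>i. Gcd (w ` (UNIV - {i})) = 1"
  shows "vanishing_ideal w
           (weighted_projective_rational_points w :: ('q::{field,finite} alg_closure ^ 'n) set set) =
         vanishing_ideal w (affine_orbits w)"
proof -
  \<comment> \<open>The index type is nonempty, so some coordinate separates the all-ones vector
    from 0.\<close>
  have "(1 :: 'q alg_closure ^ 'n) \<noteq> 0"
    by (simp add: vec_eq_iff)
  then have "orbit w (1 :: 'q alg_closure ^ 'n) \<in> weighted_projective_rational_points w"
    using one_rational_point by (auto simp: weighted_projective_rational_points_def orbits_def)
  then show ?thesis
    using assms(2) by (simp add: affine_orbits_eq_insert vanishing_ideal_insert_orbit_0)
qed

end
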